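(* Let $G$ be a regular graph and let $H$ be a regular graph on $\Delta(G)$ vertices. Then, for any choice of rotation maps, the replacement product, denoted here $G\,\mathrm{r}\,H$, satisfies $$\mathrm{tww}(G\,\mathrm{r}\,H)\ge\left\lceil\sqrt{2\cdot\Delta(H)}\right\rceil.$$
   Context: All graphs are finite and simple (no loops or multiple edges). $\Delta(G)$ is the maximum degree of $G$ (so $G$ is $\Delta(G)$-regular here). Twin-width. A trigraph $G$ has a vertex set $V(G)$, a set $E(G)$ of black edges and a set $R(G)$ of red edges, with $E(G)\cap R(G)=\emptyset$; a graph is a trigraph with no red edges. $N_G(v)$ is the set of vertices joined to $v$ by a black or red edge. A $d$-trigraph is a trigraph in which every vertex is incident with at most $d$ red edges. A contraction merges two distinct (not necessarily adjacent) vertices $u,v$ into a new vertex $w$: every vertex other than $u,v$ in $N_G(u)\triangle N_G(v)$ is joined to $w$ by a red edge; every $x\in N_G(u)\cap N_G(v)$ is joined to $w$ by a black edge if $ux,vx\in E(G)$ and by a red edge otherwise; all edges not incident with $u$ or $v$ are unchanged, and $u,v$ and their incident edges are removed. A $d$-sequence of an $n$-vertex graph $G$ is a sequence of $d$-trigraphs $G_n=G,G_{n-1},\dots,G_1=K_1$ with each $G_{i-1}$ obtained from $G_i$ by one contraction. The twin-width $\mathrm{tww}(G)$ is the least $d$ such that $G$ admits a $d$-sequence. Rotation maps. Let $G$ be a $d$-regular graph with vertex set $[n]$, where at each vertex the incident edges are labelled bijectively by $[d]$ (an edge may receive different labels at its two ends). The rotation map $\mathrm{Rot}_G:[n]\times[d]\to[n]\times[d]$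 is given by $\mathrm{Rot}_G(v,i)=(w,j)$ if the $i$-th edge incident to $v$ leads to $w$ and this edge is the $j$-th edge incident to $w$. Replacement product. Let $G$ be $d$-regular on $[n]$ and $H$ be $\delta$-regular on $[d]$, with rotation maps $\mathrm{Rot}_G,\mathrm{Rot}_H$. The replacement product is the $(\delta+1)$-regular graph on $[n]\times[d]$ whose rotation map sends $((v,k),i)$ to $((v,m),j)$ with $(m,j)=\mathrm{Rot}_H(k,i)$ if $i\le\delta$, and to $(\mathrm{Rot}_G(v,k),i)$ if $i=\delta+1$. Equivalently, $(v,k)$ and $(w,l)$ are adjacent iff [$v=w$ and $kl\in E(H)$] or $\mathrm{Rot}_G(v,k)=(w,l)$. *)

theory Defs imports Complex_Main begin

record 'a trigraph =
  verts :: "'a set"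
  black :: "'a set set"
  red :: "'a set set"

definition is_trigraph :: "'a trigraph \<Rightarrow> bool" where
  "is_trigraph G \<longleftrightarrow> finite (verts G)
     \<and> (\<forall>e \<in> black G \<union> red G. e \<subseteq> verts G \<and> card e = 2)
     \<and> black G \<inter> red G = {}"

definition is_graph :: "'a trigraph \<Rightarrow> bool" where
  "is_graph G \<longleftrightarrow> is_trigraph G \<and> red G = {}"

definition nbrs :: "'a trigraph \<Rightarrow> 'a \<Rightarrow> 'a set" where
  "nbrs G v = {x. {v, x} \<in> black G \<union> red G}"

definition degree :: "'a trigraph \<Rightarrow> 'a \<Rightarrow> nat" where
  "degree G v = card (nbrs G v)"

(* The maximum degree of the graph without vertices is 0. *)
definition max_degree :: "'a trigraph \<Rightarrow> nat" where
  "max_degree G = Max (insert 0 (degree G ` verts G))"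

definition regular :: "'a trigraph \<Rightarrow> bool" where
  "regular G \<longleftrightarrow> (\<exists>k. \<forall>v \<in> verts G. degree G v = k)"

definition d_trigraph :: "nat \<Rightarrow> 'a trigraph \<Rightarrow> bool" where
  "d_trigraph d G \<longleftrightarrow> is_trigraph G \<and> (\<forall>v \<in> verts G. card {e \<in> red G. v \<in> e} \<le> d)"

definition contract :: "'a trigraph \<Rightarrow> 'a \<Rightarrow> 'a \<Rightarrow> 'a \<Rightarrow> 'a trigraph" where
  "contract G u v w =
     \<lparr> verts = insert w (verts G - {u, v}),
       black = {e \<in> black G. u \<notin> e \<and> v \<notin> e}
         \<union> {{w, x} | x. x \<in> nbrs G u \<inter> nbrs G v \<and> {u, x} \<in> black G \<and> {v, x} \<in> black G},
       red = {e \<in> red G. u \<notin> e \<and> v \<notin> e}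
         \<union> {{w, x} | x. x \<in> ((nbrs G u - nbrs G v) \<union> (nbrs G v - nbrs G u)) - {u, v}}
         \<union> {{w, x} | x. x \<in> nbrs G u \<inter> nbrs G v
                         \<and> \<not> ({u, x} \<in> black G \<and> {v, x} \<in> black G)} \<rparr>"

(* The new vertex w has to differ from all remaining vertices; it may reuse one of the names u, v,
   which have been removed, so that a fresh name exists over finite vertex types as well. *)
definition is_contraction :: "'a trigraph \<Rightarrow> 'a trigraph \<Rightarrow> bool" where
  "is_contraction G G' \<longleftrightarrow>
     (\<exists>u v w. u \<in> verts G \<and> v \<in> verts G \<and> u \<noteq> v \<and> w \<notin> verts G - {u, v} \<and> G' = contract G u v w)"

(* S i is the trigraph on i vertices.  A trigraph on one vertex has no edges, hence is K_1.
   For the graph without vertices every d is admitted, which makes its twin-width 0. *)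
definition is_d_sequence :: "nat \<Rightarrow> 'a trigraph \<Rightarrow> (nat \<Rightarrow> 'a trigraph) \<Rightarrow> bool" where
  "is_d_sequence d G S \<longleftrightarrow>
     S (card (verts G)) = G
     \<and> card (verts (S 1)) = 1
     \<and> (\<forall>i \<in> {1..card (verts G)}. d_trigraph d (S i))
     \<and> (\<forall>i \<in> {2..card (verts G)}. is_contraction (S i) (S (i - 1)))"

definition tww :: "'a trigraph \<Rightarrow> nat" where
  "tww G = (LEAST d. \<exists>S. is_d_sequence d G S)"

(* lab v e is the label of the edge e at its end v.  As lab v is onto {1..d}, the second conjunct
   determines Rot on all of verts G \<times> {1..d}; values elsewhere are irrelevant. *)
definition is_rotation_map :: "'a trigraph \<Rightarrow> nat \<Rightarrow> ('a \<times> nat \<Rightarrow> 'a \<times> nat) \<Rightarrow> bool" where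
  "is_rotation_map G d Rot \<longleftrightarrow>
     (\<exists>lab. (\<forall>v \<in> verts G. bij_betw (lab v) {e \<in> black G. v \<in> e} {1..d})
          \<and> (\<forall>v w. {v, w} \<in> black G \<longrightarrow> Rot (v, lab v {v, w}) = (w, lab w {v, w})))"

definition replacement_rot ::
  "('a \<times> nat \<Rightarrow> 'a \<times> nat) \<Rightarrow> nat \<Rightarrow> (nat \<times> nat \<Rightarrow> nat \<times> nat)
     \<Rightarrow> ('a \<times> nat) \<times> nat \<Rightarrow> ('a \<times> nat) \<times> nat" where
  "replacement_rot RotG \<delta> RotH = (\<lambda>((v, k), i).
     if i \<le> \<delta> then (let (m, j) = RotH (k, i) in ((v, m), j)) else (RotG (v, k), i))"

definition graph_of_rot :: "'a set \<Rightarrow> nat \<Rightarrow> ('a \<times> nat \<Rightarrow> 'a \<times> nat) \<Rightarrow> 'a trigraph" where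
  "graph_of_rot V d Rot =
     \<lparr> verts = V,
       black = {{x, y} | x y. x \<in> V \<and> (\<exists>i \<in> {1..d}. \<exists>j. Rot (x, i) = (y, j))},
       red = {} \<rparr>"

definition replacement_product ::
  "'a trigraph \<Rightarrow> ('a \<times> nat \<Rightarrow> 'a \<times> nat) \<Rightarrow> nat trigraph \<Rightarrow> (nat \<times> nat \<Rightarrow> nat \<times> nat)
     \<Rightarrow> ('a \<times> nat) trigraph" where
  "replacement_product G RotG H RotH =
     graph_of_rot (verts G \<times> {1..max_degree G}) (max_degree H + 1)
       (replacement_rot RotG (max_degree H) RotH)"

end

(* The vertices (v, k) with the same v form a cluster; every vertex has exactly one neighbour
   outside its cluster, and two clusters are joined by at most one edge.  As long as every part of a
   d-sequence lies in one cluster, a part with at least two vertices has a red edge for each of its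
   outer edges, so all parts have size at most max 1 d.  Consider the first contraction merging
   parts A and B of different clusters.  Inside its own cluster each of A and B sees roughly Delta(H)
   vertices, spread over parts of size at most max 1 d, and almost all of these parts become red
   neighbours of A Un B.  Counting them together with the outer red neighbours gives
   2 Delta(H) <= d^2. *)
theory Submission imports Defs begin

section \<open>Edges of trigraphs under contraction\<close>

lemma nbrs_commute: "y \<in> nbrs G x \<longleftrightarrow> x \<in> nbrs G y"
  by (simp add: nbrs_def insert_commute)

lemma is_trigraph_edge:
  assumes "is_trigraph G" "e \<in> black G \<union> red G"
  shows "e \<subseteq> verts G \<and> card e = 2"
proof -
  have "\<forall>e \<in> black G \<union> red G. e \<subseteq> verts G \<and> card e = 2"
    using assms(1) unfolding is_trigraph_def by (elim conjE)
  then show ?thesis using assms(2) by (rule bspec)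
qed

lemma is_trigraphD:
  assumes "is_trigraph G" "{x, y} \<in> black G \<union> red G"
  shows "x \<in> verts G" "y \<in> verts G" "x \<noteq> y"
  using is_trigraph_edge[OF assms] by auto

lemma finite_red:
  assumes "is_trigraph G"
  shows "finite (red G)"
proof (rule finite_subset)
  show "red G \<subseteq> Pow (verts G)" using is_trigraph_edge[OF assms] by blast
  show "finite (Pow (verts G))" using assms by (simp add: is_trigraph_def)
qed

text \<open>Every new edge contains \<open>w\<close> and no surviving old edge does, even when
  \<open>w\<close> reuses the name \<open>u\<close> or \<open>v\<close>. So old and new edges cannot
  coincide, and new edges of the two colours come from disjoint sets of neighbours.\<close>

lemma is_trigraph_contract:
  assumes G: "is_trigraph G" and w: "w \<notin> verts G - {u, v}"
  shows "is_trigraph (contract G u v w)"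
proof -
  have old: "e \<subseteq> verts G - {u, v} \<and> card e = 2" if "e \<in> black G \<union> red G" "u \<notin> e" "v \<notin> e" for e
    using is_trigraph_edge[OF G that(1)] that by blast
  have nb: "x \<in> verts G \<and> x \<noteq> y" if "x \<in> nbrs G y" for x y
    using that is_trigraphD[OF G] unfolding nbrs_def by blast
  have new: "{w, x} \<subseteq> insert w (verts G - {u, v}) \<and> card {w, x} = 2"
    if "x \<in> nbrs G u \<union> nbrs G v" "x \<notin> {u, v}" for x
    using that nb[of x u] nb[of x v] w by (auto simp: card_insert_if)
  have w_old: "w \<notin> e" if "e \<in> black G \<union> red G" "u \<notin> e" "v \<notin> e" for e
    using old[OF that] w by blast
  let ?W = "verts (contract G u v w)"
  have W: "?W = insert w (verts G - {u, v})" by (simp add: contract_def)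
  define B where "B = nbrs G u \<inter> nbrs G v \<inter> {x. {u, x} \<in> black G \<and> {v, x} \<in> black G}"
  define R where "R = ((nbrs G u - nbrs G v) \<union> (nbrs G v - nbrs G u)) - {u, v}
    \<union> (nbrs G u \<inter> nbrs G v \<inter> {x. \<not> ({u, x} \<in> black G \<and> {v, x} \<in> black G)})"
  have black: "black (contract G u v w) = {e \<in> black G. u \<notin> e \<and> v \<notin> e} \<union> (\<lambda>x. {w, x}) ` B"
    unfolding contract_def B_def by auto
  have red: "red (contract G u v w) = {e \<in> red G. u \<notin> e \<and> v \<notin> e} \<union> (\<lambda>x. {w, x}) ` R"
    unfolding contract_def R_def by auto
  \<comment> \<open>The sets of common neighbours do not remove \<open>u\<close> and
    \<open>v\<close> explicitly; the absence of loops does it.\<close>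
  have "u \<notin> nbrs G u" "v \<notin> nbrs G v" using nb by blast+
  then have BR: "x \<in> nbrs G u \<union> nbrs G v \<and> x \<notin> {u, v}" if "x \<in> B \<union> R" for x
    using that unfolding B_def R_def by blast
  have edge: "e \<subseteq> ?W \<and> card e = 2"
    if e: "e \<in> black (contract G u v w) \<union> red (contract G u v w)" for e
  proof (cases "e \<in> black G \<union> red G \<and> u \<notin> e \<and> v \<notin> e")
    case True
    then show ?thesis using old[of e] unfolding W by blast
  next
    case False
    then obtain x where x: "x \<in> B \<union> R" "e = {w, x}" using e unfolding black red by blast
    show ?thesis using new[of x] BR[OF x(1)] unfolding W x(2) by blast
  qed
  have "\<forall>e \<in> black (contract G u v w) \<union> red (contract G u v w). e \<subseteq> ?W \<and> card e = 2"
    by (intro ballI edge)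
  moreover have "black (contract G u v w) \<inter> red (contract G u v w) = {}"
  proof -
    have "B \<inter> R = {}" unfolding B_def R_def by blast
    moreover have "inj (\<lambda>x. {w, x})" by (auto simp: inj_def doubleton_eq_iff)
    ultimately have "(\<lambda>x. {w, x}) ` B \<inter> (\<lambda>x. {w, x}) ` R = {}"
      by (simp add: image_Int[symmetric])
    moreover have "black G \<inter> red G = {}" using G by (simp add: is_trigraph_def)
    moreover have "{w, x} \<notin> {e \<in> black G. u \<notin> e \<and> v \<notin> e} \<union> {e \<in> red G. u \<notin> e \<and> v \<notin> e}" for x
      using w_old[of "{w, x}"] by blast
    ultimately show ?thesis unfolding black red by blast
  qed
  moreover have "finite (verts (contract G u v w))"
    using G unfolding is_trigraph_def contract_def by simp
  ultimately show ?thesis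
    unfolding is_trigraph_def by (intro conjI)
qed

lemma is_contraction_trigraph:
  assumes "is_trigraph G" "is_contraction G G'"
  shows "is_trigraph G'"
proof -
  obtain u v w where "w \<notin> verts G - {u, v}" "G' = contract G u v w"
    using assms(2) unfolding is_contraction_def by (elim exE conjE)
  then show ?thesis using is_trigraph_contract[OF assms(1)] by simp
qed

lemma is_contraction_card_verts:
  assumes "finite (verts G)" "is_contraction G G'"
  shows "card (verts G') = card (verts G) - 1"
proof -
  obtain u v w where uvw: "u \<in> verts G" "v \<in> verts G" "u \<noteq> v" "w \<notin> verts G - {u, v}"
    "G' = contract G u v w"
    using assms(2) unfolding is_contraction_def by (elim exE conjE)
  have "card {u, v} \<le> card (verts G)"
    using uvw assms(1) by (intro card_mono) auto
  moreover have "card (verts G - {u, v}) = card (verts G) - 2"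
    using uvw by (subst card_Diff_subset) auto
  ultimately show ?thesis
    using uvw assms(1) by (simp add: contract_def)
qed

section \<open>Existence of contraction sequences\<close>

lemma ex_contraction:
  assumes "2 \<le> card (verts G)"
  shows "\<exists>G'. is_contraction G G'"
proof -
  obtain U where "U \<subseteq> verts G" "card U = 2"
    using obtain_subset_with_card_n[OF assms] by metis
  then obtain u v where "u \<in> verts G" "v \<in> verts G" "u \<noteq> v"
    unfolding card_2_iff by blast
  then show ?thesis
    unfolding is_contraction_def by blast
qed

text \<open>Since \<open>tww\<close> is a \<open>LEAST\<close>, it says something only if some
  \<open>d\<close> is attained. Contract arbitrary pairs until one vertex is left.\<close>

lemma ex_d_sequence:
  assumes G: "is_trigraph G" and "verts G \<noteq> {}"
  shows "\<exists>d S. is_d_sequence d G S"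
proof -
  define n where "n = card (verts G)"
  define f where "f = (\<lambda>T :: 'a trigraph. SOME T'. is_contraction T T')"
  \<comment> \<open>Sequences are indexed by the number of vertices left, so index \<open>i\<close>
    stands for \<open>n - i\<close> contractions.\<close>
  define S where "S = (\<lambda>i. (f ^^ (n - i)) G)"
  have n: "1 \<le> n"
    using assms by (simp add: n_def is_trigraph_def Suc_le_eq card_gt_0_iff)
  have f: "is_contraction T (f T)" if "2 \<le> card (verts T)" for T
    unfolding f_def using ex_contraction[OF that] by (rule someI_ex)
  have S_step: "S (i - 1) = f (S i)" if "i \<in> {2..n}" for i
  proof -
    have "n - (i - 1) = Suc (n - i)" using that by auto
    then show ?thesis by (simp add: S_def)
  qed
  have S: "is_trigraph (S (n - k)) \<and> card (verts (S (n - k))) = n - k" if "k < n" for k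
    using that
  proof (induction k)
    case 0
    then show ?case using G by (simp add: S_def n_def)
  next
    case (Suc k)
    then have *: "is_trigraph (S (n - k))" "card (verts (S (n - k))) = n - k" by auto
    have "S (n - Suc k) = f (S (n - k))"
      using S_step[of "n - k"] Suc.prems by simp
    moreover have "is_contraction (S (n - k)) (f (S (n - k)))"
      using * Suc.prems by (intro f) auto
    ultimately show ?case
      using * is_contraction_trigraph[of "S (n - k)"] is_contraction_card_verts[of "S (n - k)"]
      by (simp add: is_trigraph_def)
  qed
  have S': "is_trigraph (S i) \<and> card (verts (S i)) = i" if "i \<in> {1..n}" for i
    using S[of "n - i"] that n by auto
  \<comment> \<open>The total number of red edges crudely bounds every red degree.\<close>
  define d where "d = Max ((\<lambda>i. card (red (S i))) ` {1..n})"
  have "d_trigraph d (S i)" if "i \<in> {1..n}" for i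
  proof -
    have "card {e \<in> red (S i). v \<in> e} \<le> card (red (S i))" for v
      using S'[OF that] by (intro card_mono finite_red) auto
    also have "card (red (S i)) \<le> d"
      unfolding d_def using that by (intro Max_ge) auto
    finally show ?thesis
      using S'[OF that] unfolding d_trigraph_def by blast
  qed
  moreover have "is_contraction (S i) (S (i - 1))" if "i \<in> {2..n}" for i
    unfolding S_step[OF that] using S'[of i] that by (intro f) auto
  moreover have "S n = G" by (simp add: S_def)
  moreover have "card (verts (S 1)) = 1" using S'[of 1] n by simp
  ultimately have "is_d_sequence d G S"
    unfolding is_d_sequence_def n_def[symmetric] by (intro conjI ballI)
  then show ?thesis by (intro exI)
qed

section \<open>Fibres and quotient maps\<close>

lemma card_le_mult_card_image:
  assumes "finite N" "\<And>q. q \<in> f ` N \<Longrightarrow> card {x \<in> N. f x = q} \<le> s"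
  shows "card N \<le> s * card (f ` N)"
proof -
  have "card N = card (\<Union>q\<in>f ` N. {x \<in> N. f x = q})"
    by (rule arg_cong[where f = card]) auto
  also have "\<dots> \<le> (\<Sum>q\<in>f ` N. card {x \<in> N. f x = q})"
    using assms(1) by (intro card_UN_le) simp
  also have "\<dots> \<le> s * card (f ` N)"
    using sum_bounded_above[of "f ` N" "\<lambda>q. card {x \<in> N. f x = q}" s] assms(2)
    by (simp add: mult.commute)
  finally show ?thesis .
qed

text \<open>Only these one-sided conditions are needed: they force every pair of parts that is neither
  fully joined nor fully unjoined to be a red edge.\<close>
definition quotient_map :: "'v trigraph \<Rightarrow> 'p trigraph \<Rightarrow> ('v \<Rightarrow> 'p) \<Rightarrow> bool" where
  "quotient_map P T \<pi> \<longleftrightarrow> \<pi> ` verts P \<subseteq> verts T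
    \<and> (\<forall>x \<in> verts P. \<forall>y \<in> verts P. {x, y} \<in> black P \<and> \<pi> x \<noteq> \<pi> y \<longrightarrow> {\<pi> x, \<pi> y} \<in> black T \<union> red T)
    \<and> (\<forall>x \<in> verts P. \<forall>y \<in> verts P. {\<pi> x, \<pi> y} \<in> black T \<longrightarrow> {x, y} \<in> black P)"

definition fibre :: "'v trigraph \<Rightarrow> ('v \<Rightarrow> 'p) \<Rightarrow> 'p \<Rightarrow> 'v set" where
  "fibre P \<pi> p = {x \<in> verts P. \<pi> x = p}"

text \<open>The failure of homogeneity: two distinct parts related in this way can be joined neither
  by a black edge nor by none.\<close>

definition mixed :: "'v trigraph \<Rightarrow> 'v set \<Rightarrow> 'v set \<Rightarrow> bool" where
  "mixed P X Y \<longleftrightarrow> (\<exists>x\<in>X. \<exists>y\<in>Y. {x, y} \<in> black P) \<and> (\<exists>x\<in>X. \<exists>y\<in>Y. {x, y} \<notin> black P)"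

lemma quotient_map_refl: "red P = {} \<Longrightarrow> quotient_map P P (\<lambda>x. x)"
  by (auto simp: quotient_map_def)

text \<open>A contraction makes an edge at \<open>w\<close> black only where both merged vertices
  had black edges, and it loses no adjacency to a third vertex. So both edge conditions survive when
  the parts \<open>u\<close> and \<open>v\<close> are renamed \<open>w\<close>.\<close>

lemma quotient_map_contract:
  assumes T: "is_trigraph T" and Q: "quotient_map P T \<pi>" and w: "w \<notin> verts T - {u, v}"
  shows "quotient_map P (contract T u v w) (\<lambda>x. if \<pi> x \<in> {u, v} then w else \<pi> x)"
    (is "quotient_map P ?T ?\<pi>")
proof -
  have \<pi>: "\<pi> x \<in> verts T" if "x \<in> verts P" for x
    using Q that unfolding quotient_map_def by blast
  have adj: "\<pi> y \<in> nbrs T (\<pi> x)" if "x \<in> verts P" "y \<in> verts P" "{x, y} \<in> black P" "\<pi> x \<noteq> \<pi> y" for x y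
    using Q that unfolding quotient_map_def nbrs_def by blast
  have full: "{x, y} \<in> black P" if "x \<in> verts P" "y \<in> verts P" "{\<pi> x, \<pi> y} \<in> black T" for x y
    using Q that unfolding quotient_map_def by blast
  have edge_w: "{w, z} \<in> black ?T \<union> red ?T" if "z \<in> nbrs T u \<union> nbrs T v" "z \<notin> {u, v}" for z
    using that unfolding contract_def by simp blast
  have edge_old: "e \<in> black ?T \<union> red ?T" if "e \<in> black T \<union> red T" "u \<notin> e" "v \<notin> e" for e
    using that unfolding contract_def by auto
  have edge: "{?\<pi> x, ?\<pi> y} \<in> black ?T \<union> red ?T"
    if xy: "x \<in> verts P" "y \<in> verts P" "{x, y} \<in> black P" "?\<pi> x \<noteq> ?\<pi> y" for x y
  proof (cases "\<pi> x \<in> {u, v}")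
    case True
    then have "\<pi> y \<notin> {u, v}" using xy by auto
    moreover have "\<pi> y \<in> nbrs T u \<union> nbrs T v"
      using adj[of x y] xy True calculation by auto
    ultimately show ?thesis using edge_w[of "\<pi> y"] True by simp
  next
    case x: False
    show ?thesis
    proof (cases "\<pi> y \<in> {u, v}")
      case True
      have "\<pi> x \<in> nbrs T u \<union> nbrs T v"
        using adj[of x y] xy True x nbrs_commute by (metis UnI1 UnI2 insertE singletonD)
      then show ?thesis using edge_w[of "\<pi> x"] True x by (simp add: insert_commute)
    next
      case False
      then show ?thesis
        using edge_old[of "{\<pi> x, \<pi> y}"] adj[of x y] xy x by (auto simp: nbrs_def)
    qed
  qed
  have black_w: "{u, z} \<in> black T \<and> {v, z} \<in> black T"
    if "{w, z} \<in> black ?T" "z \<in> verts T - {u, v}" for z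
  proof -
    \<comment> \<open>An old edge at \<open>w\<close> would make \<open>w\<close> a vertex of
      \<open>T\<close>, hence one of \<open>u\<close> and \<open>v\<close>, which surviving edges
      avoid.\<close>
    have "{w, z} \<notin> {e \<in> black T. u \<notin> e \<and> v \<notin> e}"
      using w is_trigraphD(1)[OF T, of w z] by blast
    then show ?thesis
      using that w unfolding contract_def by (auto simp: doubleton_eq_iff)
  qed
  have black_ww: "{w, w} \<notin> black ?T"
    using is_trigraphD(3)[OF is_trigraph_contract[OF T w], of w w] by blast
  have black_old: "{y, z} \<in> black T"
    if "{y, z} \<in> black ?T" "y \<in> verts T - {u, v}" "z \<in> verts T - {u, v}" for y z
    using that w unfolding contract_def by (auto simp: doubleton_eq_iff)
  have "{x, y} \<in> black P"
    if xy: "x \<in> verts P" "y \<in> verts P" "{?\<pi> x, ?\<pi> y} \<in> black ?T" for x y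
  proof -
    have "{\<pi> x, \<pi> y} \<in> black T"
    proof (cases "\<pi> x \<in> {u, v}")
      case True
      then have "\<pi> y \<notin> {u, v}" "{w, \<pi> y} \<in> black ?T"
        using xy(3) black_ww by (auto split: if_splits)
      then show ?thesis using black_w[of "\<pi> y"] \<pi>[OF xy(2)] True by blast
    next
      case x: False
      show ?thesis
      proof (cases "\<pi> y \<in> {u, v}")
        case True
        then have "{w, \<pi> x} \<in> black ?T"
          using xy(3) x by (simp add: insert_commute)
        then have "{\<pi> y, \<pi> x} \<in> black T"
          using black_w[of "\<pi> x"] \<pi>[OF xy(1)] True x by blast
        then show ?thesis by (simp add: insert_commute)
      next
        case False
        then show ?thesis
          using xy(3) black_old[of "\<pi> x" "\<pi> y"] \<pi>[OF xy(1)] \<pi>[OF xy(2)] x by simp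
      qed
    qed
    then show ?thesis using full xy by blast
  qed
  moreover have "?\<pi> ` verts P \<subseteq> verts ?T"
    using \<pi> unfolding contract_def by auto
  ultimately show ?thesis
    unfolding quotient_map_def using edge by blast
qed

text \<open>Each \<open>q\<close> in \<open>M\<close> contributes its own red edge
  \<open>{p, q}\<close>. This is how the bound on the red degree enters the argument.\<close>

lemma card_mixed_le:
  assumes Q: "quotient_map P T \<pi>" and T: "d_trigraph d T"
    and M: "\<And>q. q \<in> M \<Longrightarrow> q \<noteq> p \<and> mixed P (fibre P \<pi> p) (fibre P \<pi> q)"
  shows "card M \<le> d"
proof (cases "M = {}")
  case False
  have \<pi>: "\<pi> x \<in> verts T" if "x \<in> verts P" for x
    using Q that unfolding quotient_map_def by blast
  have edge: "{\<pi> x, \<pi> y} \<in> black T \<union> red T"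
    if "x \<in> verts P" "y \<in> verts P" "{x, y} \<in> black P" "\<pi> x \<noteq> \<pi> y" for x y
    using Q that unfolding quotient_map_def by metis
  have full: "{x, y} \<in> black P" if "x \<in> verts P" "y \<in> verts P" "{\<pi> x, \<pi> y} \<in> black T" for x y
    using Q that unfolding quotient_map_def by metis
  have red: "{p, q} \<in> red T \<and> p \<in> verts T" if "q \<in> M" for q
  proof -
    have "mixed P (fibre P \<pi> p) (fibre P \<pi> q)" "q \<noteq> p" using M[OF that] by simp_all
    then obtain x y x' y' where
      xy: "x \<in> verts P" "\<pi> x = p" "y \<in> verts P" "\<pi> y = q" "{x, y} \<in> black P"
        "x' \<in> verts P" "\<pi> x' = p" "y' \<in> verts P" "\<pi> y' = q" "{x', y'} \<notin> black P"
      by (auto simp: mixed_def fibre_def)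
    have "{p, q} \<in> black T \<union> red T" using edge[of x y] xy \<open>q \<noteq> p\<close> by simp
    moreover have "{p, q} \<notin> black T" using full[of x' y'] xy by auto
    ultimately show ?thesis using \<pi>[of x] xy by simp
  qed
  \<comment> \<open>The red degree is bounded only at vertices of \<open>T\<close>; a nonempty
    \<open>M\<close> shows that \<open>p\<close> is one.\<close>
  then have p: "p \<in> verts T" using False by blast
  have "card M = card ((\<lambda>q. {p, q}) ` M)"
    by (rule card_image[symmetric]) (auto simp: inj_on_def doubleton_eq_iff)
  also have "\<dots> \<le> card {e \<in> red T. p \<in> e}"
    using red T by (intro card_mono) (auto simp: d_trigraph_def finite_red)
  also have "\<dots> \<le> d"
    using T p unfolding d_trigraph_def by blast
  finally show ?thesis .
qed simp

section \<open>Graphs split into clusters\<close>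

text \<open>The features of a replacement product on which the bound rests: there \<open>c\<close>
  is the first component, \<open>out\<close> is the rotation map of the graph \<open>G\<close>, and
  \<open>one_edge\<close> reflects that \<open>G\<close> is simple.\<close>

locale cluster_graph =
  fixes P :: "'v trigraph" and c :: "'v \<Rightarrow> 'c" and out :: "'v \<Rightarrow> 'v" and \<delta> :: nat
  assumes graph: "is_graph P"
    and out_verts: "x \<in> verts P \<Longrightarrow> out x \<in> verts P"
    and out_out: "x \<in> verts P \<Longrightarrow> out (out x) = x"
    and out_cluster: "x \<in> verts P \<Longrightarrow> c (out x) \<noteq> c x"
    and out_adj: "x \<in> verts P \<Longrightarrow> {x, out x} \<in> black P"
    and outer_unique: "{x, y} \<in> black P \<Longrightarrow> c x \<noteq> c y \<Longrightarrow> y = out x"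
    and one_edge: "\<lbrakk>x \<in> verts P; y \<in> verts P; c x = c y; c (out x) = c (out y)\<rbrakk> \<Longrightarrow> x = y"
    and inner_degree: "x \<in> verts P \<Longrightarrow> \<delta> \<le> card {y \<in> verts P. c y = c x \<and> {x, y} \<in> black P}"
begin

text \<open>The state of a sequence before the first contraction that merges parts of different
  clusters.\<close>

definition pure :: "('v \<Rightarrow> 'p) \<Rightarrow> bool" where
  "pure \<pi> \<longleftrightarrow> (\<forall>x \<in> verts P. \<forall>y \<in> verts P. \<pi> x = \<pi> y \<longrightarrow> c x = c y)"

lemma pureD: "\<lbrakk>pure \<pi>; x \<in> verts P; y \<in> verts P; \<pi> x = \<pi> y\<rbrakk> \<Longrightarrow> c x = c y"
  unfolding pure_def by metis

lemma finite_verts: "finite (verts P)"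
  using graph by (simp add: is_graph_def is_trigraph_def)

lemma finite_fibre: "finite (fibre P \<pi> p)"
  using finite_verts by (simp add: fibre_def)

text \<open>The outer neighbours of the part lie in different clusters by \<open>one_edge\<close>,
  hence in different parts by purity, and each of these parts is mixed with the given one. The
  hypothesis on all sets \<open>M\<close> is the bound on the red degree, stated without a
  trigraph.\<close>

lemma part_size:
  assumes pure: "pure \<pi>"
    and bound: "\<And>M. (\<And>q. q \<in> M \<Longrightarrow> q \<noteq> p \<and> mixed P (fibre P \<pi> p) (fibre P \<pi> q)) \<Longrightarrow> card M \<le> d"
    and "2 \<le> card (fibre P \<pi> p)"
  shows "card (fibre P \<pi> p) \<le> d"
proof -
  let ?A = "fibre P \<pi> p"
  have A: "x \<in> verts P" "\<pi> x = p" if "x \<in> ?A" for x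
    using that by (auto simp: fibre_def)
  have cA: "c x = c y" if "x \<in> ?A" "y \<in> ?A" for x y
    using pureD[OF pure, of x y] A[OF that(1)] A[OF that(2)] by simp
  have "inj_on (\<lambda>x. \<pi> (out x)) ?A"
  proof (rule inj_onI)
    fix x y assume xy: "x \<in> ?A" "y \<in> ?A" "\<pi> (out x) = \<pi> (out y)"
    then have "c (out x) = c (out y)"
      using pureD[OF pure, of "out x" "out y"] out_verts A by simp
    then show "x = y" using one_edge A cA xy by blast
  qed
  then have "card ?A = card ((\<lambda>x. \<pi> (out x)) ` ?A)"
    by (simp add: card_image)
  also have "\<dots> \<le> d"
  proof (rule bound)
    fix q assume "q \<in> (\<lambda>x. \<pi> (out x)) ` ?A"
    then obtain x where x: "x \<in> ?A" "q = \<pi> (out x)" by blast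
    have ne: "q \<noteq> p"
      using pureD[OF pure, of x "out x"] x A out_verts out_cluster[of x] by auto
    have "\<not> ?A \<subseteq> {x}"
    proof
      assume "?A \<subseteq> {x}"
      then have "card ?A \<le> card {x}" by (intro card_mono) auto
      then show False using assms(3) by simp
    qed
    then obtain y where y: "y \<in> ?A" "y \<noteq> x" by blast
    \<comment> \<open>Such an edge would be an outer edge of \<open>out x\<close>, and its only
      outer edge leads to \<open>x\<close>.\<close>
    have "{y, out x} \<notin> black P"
    proof
      assume "{y, out x} \<in> black P"
      then have "{out x, y} \<in> black P" by (simp add: insert_commute)
      moreover have "c (out x) \<noteq> c y"
        using out_cluster A x y cA by metis
      ultimately have "y = out (out x)" by (rule outer_unique)
      then show False using out_out A x y by simp
    qed
    moreover have "out x \<in> fibre P \<pi> q"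
      using out_verts[OF A(1)[OF x(1)]] x(2) by (simp add: fibre_def)
    moreover have "{x, out x} \<in> black P" using x A out_adj by simp
    ultimately show "q \<noteq> p \<and> mixed P ?A (fibre P \<pi> q)"
      unfolding mixed_def using ne x(1) y(1) by (intro conjI bexI)
  qed
  finally show ?thesis .
qed

lemma outerD:
  assumes "{x, y} \<in> black P" "c x \<noteq> c y"
  shows "y = out x" "x = out y"
  using outer_unique[of x y] outer_unique[of y x] assms by (simp_all add: insert_commute)

text \<open>The inner neighbours of \<open>x\<close> in its own part do not include \<open>x\<close>
  itself; this is the source of the \<open>+ 1\<close>, which the later counts use up.\<close>

lemma card_nbrs_outside:
  assumes x: "x \<in> fibre P \<pi> p"
  shows "\<delta> + 1 \<le> card {y \<in> verts P. c y = c x \<and> {x, y} \<in> black P \<and> \<pi> y \<noteq> p} + card (fibre P \<pi> p)"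
proof -
  let ?N = "{y \<in> verts P. c y = c x \<and> {x, y} \<in> black P}"
  let ?N' = "{y \<in> verts P. c y = c x \<and> {x, y} \<in> black P \<and> \<pi> y \<noteq> p}"
  have "{x, x} \<notin> black P"
    using is_trigraphD(3)[of P x x] graph by (auto simp: is_graph_def)
  then have "?N \<subseteq> ?N' \<union> (fibre P \<pi> p - {x})"
    by (auto simp: fibre_def)
  then have "card ?N \<le> card (?N' \<union> (fibre P \<pi> p - {x}))"
    using finite_verts finite_fibre by (intro card_mono) auto
  also have "\<dots> \<le> card ?N' + card (fibre P \<pi> p - {x})"
    by (rule card_Un_le)
  finally have "\<delta> \<le> card ?N' + card (fibre P \<pi> p - {x})"
    using inner_degree[of x] x by (simp add: fibre_def)
  moreover have "card (fibre P \<pi> p) = Suc (card (fibre P \<pi> p - {x}))"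
    using x finite_fibre by (metis card.remove)
  ultimately show ?thesis by simp
qed

section \<open>Merging parts of different clusters\<close>

text \<open>By purity the three images are disjoint, so their sizes add up to at most
  \<open>d\<close>. A part holds at most \<open>s\<close> vertices of \<open>N1\<close> or
  \<open>N2\<close>, whereas each vertex of \<open>K\<close> takes a part of its own and therefore
  counts with weight \<open>s\<close>. In the applications \<open>N1\<close> and \<open>N2\<close>
  consist of inner neighbours of the merged parts and \<open>K\<close> of outer ones.\<close>

lemma count_parts:
  assumes pure: "pure \<pi>" and size: "\<And>r. card (fibre P \<pi> r) \<le> s"
    and sub: "N1 \<subseteq> verts P" "N2 \<subseteq> verts P" "K \<subseteq> verts P"
    and cN1: "\<And>y. y \<in> N1 \<Longrightarrow> c y = C1" and cN2: "\<And>y. y \<in> N2 \<Longrightarrow> c y = C2"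
    and cK: "\<And>y. y \<in> K \<Longrightarrow> c y \<noteq> C1 \<and> c y \<noteq> C2" and "C1 \<noteq> C2"
    and inj: "inj_on \<pi> K"
    and M: "card (\<pi> ` N1 \<union> \<pi> ` N2 \<union> \<pi> ` K) \<le> d"
  shows "card N1 + card N2 + s * card K \<le> s * d"
proof -
  have fin: "finite N1" "finite N2" "finite K"
    using sub finite_verts finite_subset by blast+
  have disj: "\<pi> ` X \<inter> \<pi> ` Y = {}"
    if "X \<subseteq> verts P" "Y \<subseteq> verts P" "\<And>x y. x \<in> X \<Longrightarrow> y \<in> Y \<Longrightarrow> c x \<noteq> c y" for X Y
    using that pureD[OF pure] by blast
  have "\<pi> ` N1 \<inter> \<pi> ` N2 = {}"
    using sub cN1 cN2 \<open>C1 \<noteq> C2\<close> by (intro disj) auto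
  moreover have "\<pi> ` (N1 \<union> N2) \<inter> \<pi> ` K = {}"
    using sub cN1 cN2 cK by (intro disj) force+
  ultimately have "card (\<pi> ` N1 \<union> \<pi> ` N2 \<union> \<pi> ` K) = card (\<pi> ` N1) + card (\<pi> ` N2) + card (\<pi> ` K)"
    using fin by (simp add: card_Un_disjoint image_Un)
  then have sum: "card (\<pi> ` N1) + card (\<pi> ` N2) + card K \<le> d"
    using M inj by (simp add: card_image)
  have le: "card N \<le> s * card (\<pi> ` N)" if "N \<subseteq> verts P" "finite N" for N
  proof (rule card_le_mult_card_image[OF that(2)])
    fix q
    have "card {x \<in> N. \<pi> x = q} \<le> card (fibre P \<pi> q)"
      using that finite_fibre by (intro card_mono) (auto simp: fibre_def)
    then show "card {x \<in> N. \<pi> x = q} \<le> s" using size[of q] by simp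
  qed
  have "card N1 + card N2 + s * card K \<le> s * card (\<pi> ` N1) + s * card (\<pi> ` N2) + s * card K"
    using le fin sub by (simp add: add_mono)
  also have "\<dots> = s * (card (\<pi> ` N1) + card (\<pi> ` N2) + card K)"
    by (simp add: algebra_simps)
  also have "\<dots> \<le> s * d"
    using sum by (intro mult_left_mono) auto
  finally show ?thesis .
qed

text \<open>A part inside the cluster of \<open>a\<close> becomes a black neighbour of the merged part only if the
  part merged with that of \<open>a\<close> is a singleton \<open>{b}\<close> and the edge between the two clusters ends in
  \<open>b\<close>. Then this edge is not among the outer edges of the part of \<open>a\<close>, which all turn red and make
  up for the lost part.\<close>
lemma merge_bridge:
  assumes pure: "pure \<pi>" and size: "\<And>r. card (fibre P \<pi> r) \<le> max 1 d"
    and a: "a \<in> fibre P \<pi> p" and b: "fibre P \<pi> q = {b}" and cab: "c a \<noteq> c b"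
    and z: "c (out b) = c a" "\<pi> (out b) \<noteq> p"
    and bound: "\<And>M. (\<And>r. r \<in> M \<Longrightarrow> r \<noteq> p \<and> r \<noteq> q
      \<and> mixed P (fibre P \<pi> p \<union> fibre P \<pi> q) (fibre P \<pi> r)) \<Longrightarrow> card M \<le> d"
  shows "2 * \<delta> \<le> max 1 d * d"
proof -
  let ?A = "fibre P \<pi> p" and ?B = "fibre P \<pi> q"
  define Na where "Na = {y \<in> verts P. c y = c a \<and> {a, y} \<in> black P \<and> \<pi> y \<noteq> p}"
  define Nb where "Nb = {y \<in> verts P. c y = c b \<and> {b, y} \<in> black P \<and> \<pi> y \<noteq> q}"
  have bB: "b \<in> ?B" using b by simp
  have bV: "b \<in> verts P" "\<pi> b = q" and aV: "a \<in> verts P" "\<pi> a = p"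
    using a bB by (simp_all add: fibre_def)
  have A: "x \<in> verts P" "\<pi> x = p" "c x = c a" if "x \<in> ?A" for x
    using that pureD[OF pure, of x a] aV by (auto simp: fibre_def)
  have part: "\<pi> x \<noteq> \<pi> y" if "x \<in> verts P" "y \<in> verts P" "c x \<noteq> c y" for x y
    using pureD[OF pure, of x y] that by blast
  have mixedI: "mixed P (?A \<union> ?B) (fibre P \<pi> (\<pi> y))"
    if "x \<in> ?A \<union> ?B" "{x, y} \<in> black P" "x' \<in> ?A \<union> ?B" "{x', y} \<notin> black P" "y \<in> verts P" for x x' y
  proof -
    have "y \<in> fibre P \<pi> (\<pi> y)" using that(5) by (simp add: fibre_def)
    then show ?thesis using that unfolding mixed_def by (intro conjI bexI)
  qed
  \<comment> \<open>The only edge between the clusters of \<open>a\<close> and \<open>b\<close> is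
    the one at \<open>out b\<close>, and \<open>out b\<close> lies outside the part
    \<open>p\<close>.\<close>
  have cout: "c (out x) \<noteq> c a \<and> c (out x) \<noteq> c b" if "x \<in> ?A" for x
  proof
    show "c (out x) \<noteq> c a" using out_cluster A that by metis
    show "c (out x) \<noteq> c b"
    proof
      assume "c (out x) = c b"
      then have "c (out x) = c (out (out b))" using out_out bV by simp
      then have "x = out b" using one_edge[of x "out b"] A[OF that] out_verts bV z by simp
      then show False using A[OF that] z by simp
    qed
  qed
  have inj: "inj_on \<pi> (out ` ?A)"
  proof (rule inj_onI)
    fix y y' assume y: "y \<in> out ` ?A" "y' \<in> out ` ?A" "\<pi> y = \<pi> y'"
    then obtain x x' where x: "x \<in> ?A" "x' \<in> ?A" "y = out x" "y' = out x'" by blast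
    then have "c (out x) = c (out x')" using part[of y y'] y A out_verts by metis
    then show "y = y'" using one_edge[of x x'] A x by simp
  qed
  \<comment> \<open>Every vertex counted here has a neighbour in one of the merged parts and a
    non-neighbour in the other. Only \<open>out b\<close> could be a vertex of \<open>Na\<close>
    adjacent to \<open>b\<close>, so it is removed.\<close>
  have "card (\<pi> ` (Na - {out b}) \<union> \<pi> ` Nb \<union> \<pi> ` (out ` ?A)) \<le> d"
  proof (rule bound)
    fix r assume "r \<in> \<pi> ` (Na - {out b}) \<union> \<pi> ` Nb \<union> \<pi> ` (out ` ?A)"
    then consider y where "y \<in> Na" "y \<noteq> out b" "r = \<pi> y" | y where "y \<in> Nb" "r = \<pi> y"
      | x where "x \<in> ?A" "r = \<pi> (out x)" by blast
    then show "r \<noteq> p \<and> r \<noteq> q \<and> mixed P (?A \<union> ?B) (fibre P \<pi> r)"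
    proof cases
      case 1
      then have y: "y \<in> verts P" "c y = c a" "{a, y} \<in> black P" "\<pi> y \<noteq> p" by (auto simp: Na_def)
      have "{b, y} \<notin> black P" using outerD(1)[of b y] 1 y cab by auto
      then show ?thesis
        using mixedI[of a y b] part[of y b] a bB y bV cab 1 by simp
    next
      case 2
      then have y: "y \<in> verts P" "c y = c b" "{b, y} \<in> black P" "\<pi> y \<noteq> q" by (auto simp: Nb_def)
      have "{a, y} \<notin> black P" using outerD(1)[of a y] cout[OF a] y cab by auto
      then show ?thesis
        using mixedI[of b y a] part[of y a] a bB y aV cab 2 by simp
    next
      case 3
      have V: "out x \<in> verts P" using 3 A out_verts by blast
      have "{b, out x} \<notin> black P"
        using outerD(1)[of b "out x"] cout[OF 3(1)] z by metis
      then show ?thesis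
        using mixedI[of x "out x" b] part[of "out x" a] part[of "out x" b] V 3 A[OF 3(1)] aV bV bB
          cout[OF 3(1)] out_adj by simp
    qed
  qed
  then have "card (Na - {out b}) + card Nb + max 1 d * card (out ` ?A) \<le> max 1 d * d"
    using A cout out_verts cab inj size
    by (intro count_parts[OF pure, of _ _ _ _ "c a" "c b"]) (auto simp: Na_def Nb_def)
  moreover have "card (out ` ?A) = card ?A"
    using A out_out by (intro card_image inj_onI) metis
  ultimately have "card (Na - {out b}) + card Nb + max 1 d * card ?A \<le> max 1 d * d" by (simp only:)
  moreover have "card Na \<le> card (Na - {out b}) + 1"
    using diff_card_le_card_Diff[of "{out b}" Na] by simp
  moreover have "\<delta> + 1 \<le> card Na + card ?A" "\<delta> + 1 \<le> card Nb + card ?B"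
    using card_nbrs_outside[OF a] card_nbrs_outside[OF bB] by (simp_all add: Na_def Nb_def)
  \<comment> \<open>In the final count the \<open>+ 1\<close> for \<open>a\<close> pays for the
    removed \<open>out b\<close>, the \<open>+ 1\<close> for \<open>b\<close> pays for its singleton
    part, and the outer neighbours pay for the vertices of the part of \<open>a\<close>.\<close>
  moreover have "card ?A \<le> max 1 d * card ?A" "card ?B = 1" using b by simp_all
  ultimately show ?thesis by linarith
qed

text \<open>Without bridges, every vertex of \<open>Na\<close> and \<open>Nb\<close> misses some
  vertex of the opposite part, so none has to be removed. The larger part also supplies outer
  neighbours, and by \<open>le\<close> its size bounds the loss on both sides.\<close>

lemma merge_no_bridge:
  assumes pure: "pure \<pi>" and size: "\<And>r. card (fibre P \<pi> r) \<le> max 1 d"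
    and a: "a \<in> fibre P \<pi> p" and b: "b \<in> fibre P \<pi> q" and cab: "c a \<noteq> c b"
    and no_a: "\<not> (fibre P \<pi> q = {b} \<and> c (out b) = c a \<and> \<pi> (out b) \<noteq> p)"
    and no_b: "\<not> (fibre P \<pi> p = {a} \<and> c (out a) = c b \<and> \<pi> (out a) \<noteq> q)"
    and le: "card (fibre P \<pi> q) \<le> card (fibre P \<pi> p)"
    and bound: "\<And>M. (\<And>r. r \<in> M \<Longrightarrow> r \<noteq> p \<and> r \<noteq> q
      \<and> mixed P (fibre P \<pi> p \<union> fibre P \<pi> q) (fibre P \<pi> r)) \<Longrightarrow> card M \<le> d"
  shows "2 * \<delta> \<le> max 1 d * d"
proof -
  let ?A = "fibre P \<pi> p" and ?B = "fibre P \<pi> q"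
  define Na where "Na = {y \<in> verts P. c y = c a \<and> {a, y} \<in> black P \<and> \<pi> y \<noteq> p}"
  define Nb where "Nb = {y \<in> verts P. c y = c b \<and> {b, y} \<in> black P \<and> \<pi> y \<noteq> q}"
  \<comment> \<open>Outer neighbours in the cluster of \<open>b\<close> are left out because
    \<open>count_parts\<close> wants \<open>K\<close> to avoid both clusters. A singleton part has
    no second vertex that misses the outer neighbour, so its outer edge is not counted.\<close>
  define A' where "A' = (if card ?A \<le> 1 then {} else {x \<in> ?A. c (out x) \<noteq> c b})"
  have A'_sub: "A' \<subseteq> ?A" by (auto simp: A'_def)
  have bV: "b \<in> verts P" "\<pi> b = q" and aV: "a \<in> verts P" "\<pi> a = p"
    using a b by (simp_all add: fibre_def)
  have A: "x \<in> verts P" "\<pi> x = p" "c x = c a" if "x \<in> ?A" for x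
    using that pureD[OF pure, of x a] aV by (auto simp: fibre_def)
  have B: "x \<in> verts P" "\<pi> x = q" "c x = c b" if "x \<in> ?B" for x
    using that pureD[OF pure, of x b] bV by (auto simp: fibre_def)
  have part: "\<pi> x \<noteq> \<pi> y" if "x \<in> verts P" "y \<in> verts P" "c x \<noteq> c y" for x y
    using pureD[OF pure, of x y] that by blast
  have mixedI: "mixed P (?A \<union> ?B) (fibre P \<pi> (\<pi> y))"
    if "x \<in> ?A \<union> ?B" "{x, y} \<in> black P" "x' \<in> ?A \<union> ?B" "{x', y} \<notin> black P" "y \<in> verts P" for x x' y
  proof -
    have "y \<in> fibre P \<pi> (\<pi> y)" using that(5) by (simp add: fibre_def)
    then show ?thesis using that unfolding mixed_def by (intro conjI bexI)
  qed
  have cout: "c (out x) \<noteq> c a \<and> c (out x) \<noteq> c b" if "x \<in> A'" for x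
    using that out_cluster[of x] A[of x] by (auto simp: A'_def split: if_splits)
  have inj: "inj_on \<pi> (out ` A')"
  proof (rule inj_onI)
    fix y y' assume y: "y \<in> out ` A'" "y' \<in> out ` A'" "\<pi> y = \<pi> y'"
    then obtain x x' where x: "x \<in> ?A" "x' \<in> ?A" "y = out x" "y' = out x'" using A'_sub by blast
    then have "c (out x) = c (out x')" using part[of y y'] y A out_verts by metis
    then show "y = y'" using one_edge[of x x'] A x by simp
  qed
  have "card (\<pi> ` Na \<union> \<pi> ` Nb \<union> \<pi> ` (out ` A')) \<le> d"
  proof (rule bound)
    fix r assume "r \<in> \<pi> ` Na \<union> \<pi> ` Nb \<union> \<pi> ` (out ` A')"
    then consider y where "y \<in> Na" "r = \<pi> y" | y where "y \<in> Nb" "r = \<pi> y"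
      | x where "x \<in> A'" "r = \<pi> (out x)" by blast
    then show "r \<noteq> p \<and> r \<noteq> q \<and> mixed P (?A \<union> ?B) (fibre P \<pi> r)"
    proof cases
      case 1
      then have y: "y \<in> verts P" "c y = c a" "{a, y} \<in> black P" "\<pi> y \<noteq> p" by (auto simp: Na_def)
      \<comment> \<open>If all of the part \<open>q\<close> were adjacent to \<open>y\<close>, it
        would consist of the unique outer neighbour of \<open>y\<close> alone, which
        \<open>no_a\<close> excludes.\<close>
      have "\<exists>x \<in> ?B. {x, y} \<notin> black P"
      proof (rule ccontr)
        assume "\<not> ?thesis"
        then have "x = out y \<and> y = out x" if "x \<in> ?B" for x
          using that outerD[of x y] B[OF that] y cab by metis
        then have "?B = {b}" "y = out b" using b by blast+
        then show False using no_a y by simp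
      qed
      then obtain x where "x \<in> ?B" "{x, y} \<notin> black P" by blast
      then show ?thesis
        using mixedI[of a y x] part[of y b] a y bV cab 1 by simp
    next
      case 2
      then have y: "y \<in> verts P" "c y = c b" "{b, y} \<in> black P" "\<pi> y \<noteq> q" by (auto simp: Nb_def)
      have "\<exists>x \<in> ?A. {x, y} \<notin> black P"
      proof (rule ccontr)
        assume "\<not> ?thesis"
        then have "x = out y \<and> y = out x" if "x \<in> ?A" for x
          using that outerD[of x y] A[OF that] y cab by metis
        then have "?A = {a}" "y = out a" using a by blast+
        then show False using no_b y by simp
      qed
      then obtain x where "x \<in> ?A" "{x, y} \<notin> black P" by blast
      then show ?thesis
        using mixedI[of b y x] part[of y a] b y aV cab 2 by simp
    next
      case 3
      have x: "x \<in> ?A" using 3 A'_sub by blast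
      have V: "out x \<in> verts P" using x A out_verts by blast
      have "\<not> ?A \<subseteq> {x}"
      proof
        assume "?A \<subseteq> {x}"
        then have "card ?A \<le> card {x}" by (intro card_mono) auto
        then show False using 3 by (simp add: A'_def)
      qed
      then obtain x' where x': "x' \<in> ?A" "x' \<noteq> x" by blast
      have "{x', out x} \<notin> black P"
      proof
        assume "{x', out x} \<in> black P"
        then have "x' = out (out x)"
          using outerD(2)[of x' "out x"] cout[OF 3(1)] A[OF x'(1)] by metis
        then show False using out_out A[OF x] x' by simp
      qed
      then show ?thesis
        using mixedI[of x "out x" x'] part[of "out x" a] part[of "out x" b] V 3 x x' A[OF x] aV bV
          cout[OF 3(1)] out_adj by simp
    qed
  qed
  then have "card Na + card Nb + max 1 d * card (out ` A') \<le> max 1 d * d"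
    using A A'_sub cout out_verts cab inj size
    by (intro count_parts[OF pure, of _ _ _ _ "c a" "c b"]) (auto simp: Na_def Nb_def)
  moreover have "card (out ` A') = card A'"
    using A A'_sub out_out by (intro card_image inj_onI) (metis subsetD)
  ultimately have "card Na + card Nb + max 1 d * card A' \<le> max 1 d * d" by (simp only:)
  moreover have "\<delta> + 1 \<le> card Na + card ?A" "\<delta> + 1 \<le> card Nb + card ?B"
    using card_nbrs_outside[OF a] card_nbrs_outside[OF b] by (simp_all add: Na_def Nb_def)
  \<comment> \<open>If the part has at least two vertices, only an end of the single edge between
    the two clusters can be missing from \<open>A'\<close>, and all other vertices count with weight
    \<open>max 1 d \<ge> 2\<close>.\<close>
  moreover have "2 * card ?A \<le> max 1 d * card A' + 2"
  proof (cases "card ?A \<le> 1")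
    case False
    have "card (?A - A') \<le> 1"
    proof -
      have "x = y" if "x \<in> ?A - A'" "y \<in> ?A - A'" for x y
        using that False one_edge[of x y] A[of x] A[of y] by (auto simp: A'_def)
      moreover have "finite (?A - A')" by (simp add: finite_fibre)
      ultimately show ?thesis unfolding One_nat_def by (subst card_le_Suc0_iff_eq) blast+
    qed
    moreover have "card ?A = card A' + card (?A - A')"
      using A'_sub finite_fibre by (metis card_Diff_subset card_mono finite_subset le_add_diff_inverse)
    moreover have "2 \<le> max 1 d" using False size[of p] by simp
    then have "2 * card A' \<le> max 1 d * card A'" by (rule mult_le_mono1)
    ultimately show ?thesis by linarith
  qed simp
  ultimately show ?thesis using le by linarith
qed

text \<open>The situation is symmetric in the two parts, as \<open>bound'\<close> makes explicit. So
  \<open>merge_bridge\<close> applies from whichever side has a bridge, and otherwise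
  \<open>merge_no_bridge\<close> applies with the larger part first.\<close>

lemma merge:
  assumes pure: "pure \<pi>" and size: "\<And>r. card (fibre P \<pi> r) \<le> max 1 d"
    and a: "a \<in> fibre P \<pi> p" and b: "b \<in> fibre P \<pi> q" and cab: "c a \<noteq> c b"
    and bound: "\<And>M. (\<And>r. r \<in> M \<Longrightarrow> r \<noteq> p \<and> r \<noteq> q
      \<and> mixed P (fibre P \<pi> p \<union> fibre P \<pi> q) (fibre P \<pi> r)) \<Longrightarrow> card M \<le> d"
  shows "2 * \<delta> \<le> d\<^sup>2"
proof -
  have bound': "card M \<le> d" if "\<And>r. r \<in> M \<Longrightarrow> r \<noteq> q \<and> r \<noteq> p
      \<and> mixed P (fibre P \<pi> q \<union> fibre P \<pi> p) (fibre P \<pi> r)" for M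
    using that by (intro bound) (simp add: Un_commute)
  consider (a) "fibre P \<pi> q = {b}" "c (out b) = c a" "\<pi> (out b) \<noteq> p"
    | (b) "fibre P \<pi> p = {a}" "c (out a) = c b" "\<pi> (out a) \<noteq> q"
    | (none) "\<not> (fibre P \<pi> q = {b} \<and> c (out b) = c a \<and> \<pi> (out b) \<noteq> p)"
      "\<not> (fibre P \<pi> p = {a} \<and> c (out a) = c b \<and> \<pi> (out a) \<noteq> q)" by blast
  then have "2 * \<delta> \<le> max 1 d * d"
  proof cases
    case a
    then show ?thesis by (intro merge_bridge[OF pure size \<open>a \<in> _\<close> _ cab _ _ bound])
  next
    case b
    then show ?thesis by (intro merge_bridge[OF pure size \<open>b \<in> _\<close> _ cab[symmetric] _ _ bound'])
  next
    case none
    show ?thesis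
    proof (cases "card (fibre P \<pi> q) \<le> card (fibre P \<pi> p)")
      case True
      then show ?thesis
        by (intro merge_no_bridge[OF pure size a b cab none _ bound])
    next
      case False
      then show ?thesis
        by (intro merge_no_bridge[OF pure size b a cab[symmetric] none(2,1) _ bound']) simp
    qed
  qed
  \<comment> \<open>\<open>max 1 d * d\<close> equals \<open>d\<^sup>2\<close> also for
    \<open>d = 0\<close>.\<close>
  then show ?thesis by (cases d) (simp_all add: power2_eq_square)
qed

section \<open>Contraction sequences of cluster graphs\<close>

text \<open>Only the new part can be impure, so it is the union of two parts in different clusters.
  Part sizes are bounded by the trigraph before the contraction, the red degree of the union by the
  one after it; \<open>merge\<close> combines the two.\<close>

lemma impure_contraction:
  assumes T: "d_trigraph d T" and Q: "quotient_map P T \<pi>" and pure: "pure \<pi>"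
    and w: "w \<notin> verts T - {u, v}" and "u \<noteq> v" and T': "d_trigraph d (contract T u v w)"
    and impure: "\<not> pure (\<lambda>x. if \<pi> x \<in> {u, v} then w else \<pi> x)" (is "\<not> pure ?\<pi>")
  shows "2 * \<delta> \<le> d\<^sup>2"
proof -
  have \<pi>: "\<pi> x \<in> verts T" if "x \<in> verts P" for x
    using Q that unfolding quotient_map_def by blast
  obtain x y where xy: "x \<in> verts P" "y \<in> verts P" "?\<pi> x = ?\<pi> y" "c x \<noteq> c y"
    using impure unfolding pure_def by blast
  have ne: "\<pi> x \<noteq> \<pi> y" using xy pureD[OF pure, of x y] by blast
  have old: "\<pi> z \<noteq> w" if "z \<in> verts P" "\<pi> z \<notin> {u, v}" for z
    using \<pi> that w by blast
  have uv: "{\<pi> x, \<pi> y} = {u, v}"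
    using xy ne old[of x] old[of y] by (auto split: if_splits)
  have Q': "quotient_map P (contract T u v w) ?\<pi>"
    using T w Q by (intro quotient_map_contract) (simp_all add: d_trigraph_def)
  have fib_w: "fibre P ?\<pi> w = fibre P \<pi> (\<pi> x) \<union> fibre P \<pi> (\<pi> y)"
  proof -
    have "fibre P ?\<pi> w = {z \<in> verts P. \<pi> z \<in> {u, v}}"
      using old by (auto simp: fibre_def)
    then show ?thesis unfolding uv[symmetric] by (auto simp: fibre_def)
  qed
  show ?thesis
  proof (rule merge[OF pure])
    show "card (fibre P \<pi> r) \<le> max 1 d" for r
    proof (cases "2 \<le> card (fibre P \<pi> r)")
      case True
      have "card (fibre P \<pi> r) \<le> d"
        using card_mixed_le[OF Q T] True by (intro part_size[OF pure]) blast+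
      then show ?thesis by simp
    qed simp
    show "x \<in> fibre P \<pi> (\<pi> x)" "y \<in> fibre P \<pi> (\<pi> y)" using xy by (simp_all add: fibre_def)
    show "c x \<noteq> c y" by fact
    fix M assume M: "\<And>r. r \<in> M \<Longrightarrow> r \<noteq> \<pi> x \<and> r \<noteq> \<pi> y
      \<and> mixed P (fibre P \<pi> (\<pi> x) \<union> fibre P \<pi> (\<pi> y)) (fibre P \<pi> r)"
    show "card M \<le> d"
    proof (rule card_mixed_le[OF Q' T'])
      fix r assume r: "r \<in> M"
      then have r_uv: "r \<notin> {u, v}" using M[OF r] unfolding uv[symmetric] by blast
      obtain z where "z \<in> verts P" "\<pi> z = r"
        using M[OF r] unfolding mixed_def fibre_def by blast
      \<comment> \<open>A nonempty part outside \<open>{u, v}\<close> bears the name of a remaining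
        vertex, which \<open>w\<close> is not.\<close>
      then have "r \<noteq> w" using old r_uv by blast
      moreover have "fibre P ?\<pi> r = fibre P \<pi> r"
        using r_uv calculation by (auto simp: fibre_def)
      ultimately show "r \<noteq> w \<and> mixed P (fibre P ?\<pi> w) (fibre P ?\<pi> r)"
        using M[OF r] fib_w by simp
    qed
  qed
qed

text \<open>If the inequality failed, purity would survive every contraction. But the single vertex
  at the end stands for both \<open>x\<close> and \<open>out x\<close>, which lie in different
  clusters.\<close>

lemma d_sequence_bound:
  assumes S: "is_d_sequence d P S" and "verts P \<noteq> {}"
  shows "2 * \<delta> \<le> d\<^sup>2"
proof (rule ccontr)
  assume contr: "\<not> ?thesis"
  let ?n = "card (verts P)"
  have n: "1 \<le> ?n" using assms(2) finite_verts by (simp add: Suc_le_eq card_gt_0_iff)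
  \<comment> \<open>The induction descends from the whole graph, where all parts are singletons, to
    index 1.\<close>
  have "\<exists>\<pi>. quotient_map P (S 1) \<pi> \<and> pure \<pi>"
    using n
  proof (induction rule: inc_induct)
    case base
    have "quotient_map P (S ?n) (\<lambda>x. x)"
      using S graph quotient_map_refl[of P] by (simp add: is_d_sequence_def is_graph_def)
    then show ?case unfolding pure_def by blast
  next
    case (step i)
    then obtain \<pi> where Q: "quotient_map P (S (Suc i)) \<pi>" and pure: "pure \<pi>" by blast
    have T: "d_trigraph d (S (Suc i))" "d_trigraph d (S i)" and C: "is_contraction (S (Suc i)) (S i)"
      using S step.hyps bspec[of "{2..?n}" "\<lambda>i. is_contraction (S i) (S (i - 1))" "Suc i"]
      unfolding is_d_sequence_def by auto
    obtain u v w where uvw: "u \<noteq> v" "w \<notin> verts (S (Suc i)) - {u, v}"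
      "S i = contract (S (Suc i)) u v w"
      using C unfolding is_contraction_def by (elim exE conjE)
    have "pure (\<lambda>x. if \<pi> x \<in> {u, v} then w else \<pi> x)"
      using impure_contraction[OF T(1) Q pure uvw(2,1)] T(2) contr uvw(3) by metis
    moreover have "quotient_map P (S i) (\<lambda>x. if \<pi> x \<in> {u, v} then w else \<pi> x)"
      unfolding uvw(3) using Q uvw(2) T by (intro quotient_map_contract) (simp_all add: d_trigraph_def)
    ultimately show ?case by blast
  qed
  then obtain \<pi> where Q: "quotient_map P (S 1) \<pi>" and pure: "pure \<pi>" by blast
  obtain p where p: "verts (S 1) = {p}"
    using S unfolding is_d_sequence_def by (metis card_1_singletonE)
  obtain x where x: "x \<in> verts P" using assms(2) by blast
  have "\<pi> x = p" "\<pi> (out x) = p"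
    using Q p x out_verts[OF x] unfolding quotient_map_def by blast+
  then show False using pureD[OF pure, of x "out x"] x out_verts[OF x] out_cluster[OF x] by simp
qed

end

section \<open>The replacement product as a cluster graph\<close>

lemma rotation_map_labels:
  assumes G: "is_graph G" and R: "is_rotation_map G d Rot"
  obtains lab where
    "\<And>v k. v \<in> verts G \<Longrightarrow> k \<in> {1..d} \<Longrightarrow>
      \<exists>w. {v, w} \<in> black G \<and> lab v {v, w} = k \<and> Rot (v, k) = (w, lab w {v, w})"
    "\<And>v w. {v, w} \<in> black G \<Longrightarrow> v \<in> verts G \<and> w \<in> verts G \<and> v \<noteq> w \<and> lab v {v, w} \<in> {1..d}
      \<and> lab w {v, w} \<in> {1..d} \<and> Rot (v, lab v {v, w}) = (w, lab w {v, w})"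
proof -
  have tri: "is_trigraph G" using G by (simp add: is_graph_def)
  obtain lab where bij: "\<And>v. v \<in> verts G \<Longrightarrow> bij_betw (lab v) {e \<in> black G. v \<in> e} {1..d}"
    and rot: "\<And>v w. {v, w} \<in> black G \<Longrightarrow> Rot (v, lab v {v, w}) = (w, lab w {v, w})"
    using R unfolding is_rotation_map_def by metis
  show thesis
  proof
    fix v k assume v: "v \<in> verts G" and "k \<in> {1..d}"
    then have "k \<in> lab v ` {e \<in> black G. v \<in> e}"
      using bij_betw_imp_surj_on[OF bij[OF v]] by simp
    then obtain e where e: "e \<in> black G" "v \<in> e" "lab v e = k" by auto
    have "card e = 2" using is_trigraph_edge[OF tri, of e] e by simp
    then obtain w where "e = {v, w}" using e(2) unfolding card_2_iff by (metis doubleton_eq_iff insertE singletonD)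
    then show "\<exists>w. {v, w} \<in> black G \<and> lab v {v, w} = k \<and> Rot (v, k) = (w, lab w {v, w})"
      using e rot[of v w] by auto
  next
    fix v w assume e: "{v, w} \<in> black G"
    then have vw: "v \<in> verts G" "w \<in> verts G" "v \<noteq> w" using is_trigraphD[OF tri, of v w] by simp_all
    have "lab v {v, w} \<in> {1..d}" "lab w {v, w} \<in> {1..d}"
      using e bij_betw_apply[OF bij[OF vw(1)], of "{v, w}"] bij_betw_apply[OF bij[OF vw(2)], of "{v, w}"]
      by simp_all
    then show "v \<in> verts G \<and> w \<in> verts G \<and> v \<noteq> w \<and> lab v {v, w} \<in> {1..d}
      \<and> lab w {v, w} \<in> {1..d} \<and> Rot (v, lab v {v, w}) = (w, lab w {v, w})"
      using vw rot[OF e] by blast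
  qed
qed

text \<open>Labels up to \<open>\<delta>\<close> move inside a cluster, and the last label follows
  \<open>RotG\<close>. The edge is matched as an unordered pair because \<open>graph_of_rot\<close>
  may produce it from either end.\<close>

lemma black_replacement_product:
  fixes G H RotG RotH
  defines "V \<equiv> verts G \<times> {1..max_degree G}" and "\<delta> \<equiv> max_degree H"
  shows "{x, y} \<in> black (replacement_product G RotG H RotH) \<longleftrightarrow>
    (\<exists>a b. {x, y} = {a, b} \<and> a \<in> V \<and>
      (b = RotG a \<or> (\<exists>i\<in>{1..\<delta>}. b = (fst a, fst (RotH (snd a, i))))))"
proof -
  have rot: "(\<exists>i\<in>{1..\<delta> + 1}. \<exists>j. replacement_rot RotG \<delta> RotH (a, i) = (b, j)) \<longleftrightarrow>
    b = RotG a \<or> (\<exists>i\<in>{1..\<delta>}. b = (fst a, fst (RotH (snd a, i))))" for a b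
  proof -
    have "{1..\<delta> + 1} = insert (\<delta> + 1) {1..\<delta>}" by auto
    then have "(\<exists>i\<in>{1..\<delta> + 1}. \<exists>j. replacement_rot RotG \<delta> RotH (a, i) = (b, j)) \<longleftrightarrow>
      (\<exists>j. replacement_rot RotG \<delta> RotH (a, \<delta> + 1) = (b, j)) \<or>
      (\<exists>i\<in>{1..\<delta>}. \<exists>j. replacement_rot RotG \<delta> RotH (a, i) = (b, j))"
      by (simp only: bex_simps)
    moreover have "(\<exists>j. replacement_rot RotG \<delta> RotH (a, \<delta> + 1) = (b, j)) \<longleftrightarrow> b = RotG a"
      by (auto simp: replacement_rot_def split: prod.splits)
    moreover have "(\<exists>j. replacement_rot RotG \<delta> RotH (a, i) = (b, j)) \<longleftrightarrow>
      b = (fst a, fst (RotH (snd a, i)))" if "i \<in> {1..\<delta>}" for i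
      using that by (auto simp: replacement_rot_def Let_def split: prod.splits)
    ultimately show ?thesis by simp
  qed
  show ?thesis
    unfolding replacement_product_def graph_of_rot_def V_def[symmetric] \<delta>_def[symmetric] trigraph.select_convs
      mem_Collect_eq rot ..
qed

lemma cluster_graph_replacement_product:
  assumes G: "is_graph G" and H: "is_graph H" "verts H = {1..max_degree G}"
    and RotG: "is_rotation_map G (max_degree G) RotG"
    and RotH: "is_rotation_map H (max_degree H) RotH"
  shows "cluster_graph (replacement_product G RotG H RotH) fst RotG (max_degree H)"
proof -
  let ?P = "replacement_product G RotG H RotH"
  define D where "D = max_degree G"
  define \<delta> where "\<delta> = max_degree H"
  have V: "verts ?P = verts G \<times> {1..D}"
    by (simp add: replacement_product_def graph_of_rot_def D_def)
  obtain lab where labG: "\<And>v k. v \<in> verts G \<Longrightarrow> k \<in> {1..D} \<Longrightarrow>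
      \<exists>w. {v, w} \<in> black G \<and> lab v {v, w} = k \<and> RotG (v, k) = (w, lab w {v, w})"
    and edgeG: "\<And>v w. {v, w} \<in> black G \<Longrightarrow> v \<in> verts G \<and> w \<in> verts G \<and> v \<noteq> w
      \<and> lab v {v, w} \<in> {1..D} \<and> lab w {v, w} \<in> {1..D} \<and> RotG (v, lab v {v, w}) = (w, lab w {v, w})"
    using rotation_map_labels[OF G RotG] unfolding D_def by blast
  obtain labH where labH: "\<And>k i. k \<in> {1..D} \<Longrightarrow> i \<in> {1..\<delta>} \<Longrightarrow>
      \<exists>m. {k, m} \<in> black H \<and> labH k {k, m} = i \<and> RotH (k, i) = (m, labH m {k, m})"
    and edgeH: "\<And>k m. {k, m} \<in> black H \<Longrightarrow> k \<in> {1..D} \<and> m \<in> {1..D} \<and> k \<noteq> m"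
    using rotation_map_labels[OF H(1) RotH] unfolding \<delta>_def H(2) D_def by metis
  \<comment> \<open>The last conjunct recovers the second component of \<open>x\<close> from the
    clusters of \<open>x\<close> and \<open>RotG x\<close>; \<open>one_edge\<close> follows from
    it.\<close>
  have out: "RotG x \<in> verts ?P \<and> fst (RotG x) \<noteq> fst x \<and> RotG (RotG x) = x
      \<and> snd x = lab (fst x) {fst x, fst (RotG x)}" if xV: "x \<in> verts ?P" for x
  proof -
    obtain v k where x: "x = (v, k)" "v \<in> verts G" "k \<in> {1..D}" using xV unfolding V by auto
    obtain w where w: "{v, w} \<in> black G" "lab v {v, w} = k" "RotG (v, k) = (w, lab w {v, w})"
      using labG x by blast
    then have "RotG (w, lab w {v, w}) = (v, k)"
      using edgeG[of w v] by (simp add: insert_commute)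
    moreover have "w \<noteq> v" using edgeG[OF w(1)] by blast
    ultimately show ?thesis using x w edgeG[OF w(1)] V by simp
  qed
  have inner: "(fst x, fst (RotH (snd x, i))) \<in> verts ?P \<and> fst (RotH (snd x, i)) \<noteq> snd x"
    if x: "x \<in> verts ?P" and i: "i \<in> {1..\<delta>}" for x i
  proof -
    obtain m where "{snd x, m} \<in> black H" "RotH (snd x, i) = (m, labH m {snd x, m})"
      using labH[of "snd x" i] x i V by auto
    then show ?thesis using edgeH[of "snd x" m] x V by auto
  qed
  have black: "{x, y} \<in> black ?P \<longleftrightarrow> (\<exists>a b. {x, y} = {a, b} \<and> a \<in> verts ?P \<and>
      (b = RotG a \<or> (\<exists>i\<in>{1..\<delta>}. b = (fst a, fst (RotH (snd a, i))))))" for x y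
    using black_replacement_product[of x y G RotG H RotH] unfolding V D_def \<delta>_def .
  show ?thesis
    unfolding \<delta>_def[symmetric]
  proof
    show "is_graph ?P"
    proof -
      have "finite (verts G)" using G by (simp add: is_graph_def is_trigraph_def)
      moreover have "e \<subseteq> verts ?P \<and> card e = 2" if eP: "e \<in> black ?P" for e
      proof -
        obtain x y where e: "e = {x, y}"
          using eP unfolding replacement_product_def graph_of_rot_def by auto
        then obtain a b where ab: "e = {a, b}" "a \<in> verts ?P"
          "b = RotG a \<or> (\<exists>i\<in>{1..\<delta>}. b = (fst a, fst (RotH (snd a, i))))"
          using eP unfolding e black by blast
        then have "b \<in> verts ?P \<and> a \<noteq> b"
        proof (elim disjE bexE)
          assume "b = RotG a"
          then show ?thesis using out[OF ab(2)] by auto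
        next
          fix i assume "i \<in> {1..\<delta>}" "b = (fst a, fst (RotH (snd a, i)))"
          then show ?thesis using inner[OF ab(2)] by (metis snd_conv)
        qed
        then show ?thesis using ab by simp
      qed
      moreover have "red ?P = {}" by (simp add: replacement_product_def graph_of_rot_def)
      ultimately show ?thesis using V by (simp add: is_graph_def is_trigraph_def)
    qed
  next
    fix x assume "x \<in> verts ?P"
    then show "RotG x \<in> verts ?P" "RotG (RotG x) = x" "fst (RotG x) \<noteq> fst x"
      using out by blast+
    show "{x, RotG x} \<in> black ?P" using black[of x "RotG x"] \<open>x \<in> verts ?P\<close> by blast
  next
    fix x y assume "{x, y} \<in> black ?P" and ne: "fst x \<noteq> fst y"
    then obtain a b where ab: "{x, y} = {a, b}" "a \<in> verts ?P"
      "b = RotG a \<or> (\<exists>i\<in>{1..\<delta>}. b = (fst a, fst (RotH (snd a, i))))"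
      using black[of x y] by blast
    have "fst a \<noteq> fst b" using ab(1) ne by (auto simp: doubleton_eq_iff)
    \<comment> \<open>Edges from \<open>H\<close> keep the first component, so this one comes from
      \<open>RotG\<close>, whose involutivity covers both orientations.\<close>
    then have "b = RotG a" using ab(3) by auto
    then show "y = RotG x" using ab(1) out[OF ab(2)] by (auto simp: doubleton_eq_iff)
  next
    fix x y assume "x \<in> verts ?P" "y \<in> verts ?P" "fst x = fst y" "fst (RotG x) = fst (RotG y)"
    then show "x = y" using out[of x] out[of y] by (simp add: prod_eq_iff)
  next
    fix x assume x: "x \<in> verts ?P"
    let ?f = "\<lambda>i. (fst x, fst (RotH (snd x, i)))"
    have sx: "snd x \<in> {1..D}" using x V by auto
    \<comment> \<open>A label is recovered from its edge in \<open>H\<close>, so different labels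
      lead to different neighbours.\<close>
    have "inj_on ?f {1..\<delta>}"
    proof (rule inj_onI)
      fix i j assume ij: "i \<in> {1..\<delta>}" "j \<in> {1..\<delta>}" "?f i = ?f j"
      then show "i = j" using labH[OF sx ij(1)] labH[OF sx ij(2)] by auto
    qed
    then have "\<delta> = card (?f ` {1..\<delta>})" by (simp add: card_image)
    also have "\<dots> \<le> card {y \<in> verts ?P. fst y = fst x \<and> {x, y} \<in> black ?P}"
    proof (rule card_mono)
      have "finite (verts G)" using G by (simp add: is_graph_def is_trigraph_def)
      then show "finite {y \<in> verts ?P. fst y = fst x \<and> {x, y} \<in> black ?P}" using V by simp
      show "?f ` {1..\<delta>} \<subseteq> {y \<in> verts ?P. fst y = fst x \<and> {x, y} \<in> black ?P}"
      proof (rule image_subsetI)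
        fix i assume i: "i \<in> {1..\<delta>}"
        then have "{x, ?f i} \<in> black ?P" unfolding black using x by blast
        then show "?f i \<in> {y \<in> verts ?P. fst y = fst x \<and> {x, y} \<in> black ?P}"
          using inner[OF x i] by simp
      qed
    qed
    finally show "\<delta> \<le> card {y \<in> verts ?P. fst y = fst x \<and> {x, y} \<in> black ?P}" .
  qed
qed

theorem theorem4p4:
  fixes G :: "'a trigraph" and H :: "nat trigraph"
    and RotG :: "'a \<times> nat \<Rightarrow> 'a \<times> nat" and RotH :: "nat \<times> nat \<Rightarrow> nat \<times> nat"
  assumes "is_graph G" and "regular G"
    and "is_graph H" and "regular H" and "verts H = {1..max_degree G}"
    and "is_rotation_map G (max_degree G) RotG"
    and "is_rotation_map H (max_degree H) RotH"
  shows "int (tww (replacement_product G RotG H RotH)) \<ge> \<lceil>sqrt (2 * real (max_degree H))\<rceil>"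
proof -
  let ?P = "replacement_product G RotG H RotH"
  interpret cluster_graph ?P fst RotG "max_degree H"
    using assms by (intro cluster_graph_replacement_product)
  have "2 * max_degree H \<le> (tww ?P)\<^sup>2"
  proof (cases "verts ?P = {}")
    case True
    \<comment> \<open>Here \<open>d_sequence_bound\<close> does not apply, but
      \<open>max_degree G\<close> is 0, by convention if \<open>G\<close> has no vertices. So
      \<open>H\<close> has no vertices and \<open>max_degree H\<close> is 0 as well.\<close>
    then have "verts G = {} \<or> max_degree G = 0"
      by (auto simp: replacement_product_def graph_of_rot_def)
    then have "verts H = {}" using assms(5) by (auto simp: max_degree_def)
    then show ?thesis by (simp add: max_degree_def)
  next
    case False
    have "\<exists>d S. is_d_sequence d ?P S"
      using graph False by (intro ex_d_sequence) (simp_all add: is_graph_def)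
    then have "\<exists>S. is_d_sequence (tww ?P) ?P S"
      unfolding tww_def by (rule LeastI_ex)
    then show ?thesis using d_sequence_bound False by blast
  qed
  then have "real (2 * max_degree H) \<le> real ((tww ?P)\<^sup>2)"
    by (rule of_nat_mono)
  then have "sqrt (2 * real (max_degree H)) \<le> real (tww ?P)"
    by (intro real_le_lsqrt) simp_all
  \<comment> \<open>The twin-width is an integer, so the ceiling costs nothing.\<close>
  then show ?thesis by (simp add: ceiling_le_iff)
qed

end
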